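(* Every finite tournament is a subtournament of a finite Type-II regular tournament. That is, for every finite tournament $T$ there exist a finite regular tournament $R$ of Type-II and an injective map $f$ from the vertex set of $T$ to the vertex set of $R$ such that for all vertices $x,y$ of $T$, $x\to y$ in $T$ if and only if $f(x)\to f(y)$ in $R$.
   Context: A tournament is a pair $T=(V,E)$, where $V$ is a finite nonempty set of vertices and $E\subseteq V\times V$ is a relation such that $(v,v)\notin E$ for all $v$, and for any two distinct $u,v\in V$ exactly one of $(u,v)\in E$, $(v,u)\in E$ holds. We write $u\to v$ when $(u,v)\in E$. For a vertex $v$, let $\mathrm{IN}(v)=\{u\in V: u\to v\}$ and $\mathrm{OUT}(v)=\{u\in V: v\to u\}$; each of these sets (possibly empty) is regarded as carrying the edge relation induced from $T$. A tournament is regular if $|\mathrm{IN}(v)|=|\mathrm{OUT}(v)|$ for every vertex $v$. The inversion of a tournament $(V,E)$ is $(V,E^* )$ with $E^*=\{(v,u): (u,v)\in E\}$, i.e. all arrows are reversed. A regular tournament is of Type-II if there exists a vertex $v$ such that the induced subtournament on $\mathrm{IN}(v)$ is isomorphic to the inversion of the induced subtournament on $\mathrm{OUT}(v)$, i.e. there is a bijection $g:\mathrm{IN}(v)\to\mathrm{OUT}(v)$ such that for all $x,y\in \mathrm{IN}(v)$, $x\to y$ if and only if $g(y)\to g(x)$. *)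

theory Defs
  imports Main
begin

locale tournament =
  fixes V :: "'a set" and E :: "'a rel"
  assumes finite_verts: "finite V"
    and verts_nonempty: "V \<noteq> {}"
    and edges_subset: "E \<subseteq> V \<times> V"
    and no_loops: "(v, v) \<notin> E"
    and exactly_one: "\<lbrakk>u \<in> V; v \<in> V; u \<noteq> v\<rbrakk> \<Longrightarrow> (u, v) \<in> E \<longleftrightarrow> (v, u) \<notin> E"

definition IN :: "'a set \<Rightarrow> 'a rel \<Rightarrow> 'a \<Rightarrow> 'a set" where
  "IN V E v = {u \<in> V. (u, v) \<in> E}"

definition OUT :: "'a set \<Rightarrow> 'a rel \<Rightarrow> 'a \<Rightarrow> 'a set" where
  "OUT V E v = {u \<in> V. (v, u) \<in> E}"

locale regular_tournament = tournament +
  assumes regular: "v \<in> V \<Longrightarrow> card (IN V E v) = card (OUT V E v)"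

text \<open>Isomorphism is defined for arbitrary vertex sets with an edge relation, possibly empty,
  since \<open>IN V E v\<close> and \<open>OUT V E v\<close> may be empty.\<close>

definition isomorphic :: "'a set \<Rightarrow> 'a rel \<Rightarrow> 'b set \<Rightarrow> 'b rel \<Rightarrow> bool" where
  "isomorphic V E W F \<longleftrightarrow>
     (\<exists>g. bij_betw g V W \<and> (\<forall>x\<in>V. \<forall>y\<in>V. (x, y) \<in> E \<longleftrightarrow> (g x, g y) \<in> F))"

text \<open>The edge relation induced on \<open>A\<close> is \<open>Restr E A\<close>, and the inversion of \<open>(V, E)\<close> is
  \<open>(V, E\<inverse>)\<close>.\<close>

locale type_II_tournament = regular_tournament +
  assumes type_II: "\<exists>v\<in>V. isomorphic (IN V E v) (Restr E (IN V E v))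
                                      (OUT V E v) ((Restr E (OUT V E v))\<inverse>)"

end

theory Submission
  imports Defs
begin

text \<open>In a circulant tournament on \<open>\<int>/m\<close> the reflection \<open>u \<mapsto> 2v - u\<close> reverses all arrows and fixes
  \<open>v\<close>, so it inverts \<open>IN(v)\<close> onto \<open>OUT(v)\<close>; hence such a tournament is regular and of Type-II.
  Any tournament embeds into a circulant one: send its vertices to distinct powers of two, whose
  nonzero differences determine the two exponents, and take \<open>m\<close> larger than twice all of them, so
  that the arrows between the images may be prescribed independently.\<close>

definition circulant :: "nat \<Rightarrow> int set \<Rightarrow> nat rel" where
  "circulant m S = {(u, v). u < m \<and> v < m \<and> (int v - int u) mod int m \<in> S}"

definition reflect :: "nat \<Rightarrow> nat \<Rightarrow> nat \<Rightarrow> nat" where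
  "reflect m v u = nat ((2 * int v - int u) mod int m)"

lemma int_reflect: "m > 0 \<Longrightarrow> int (reflect m v u) = (2 * int v - int u) mod int m"
  by (simp add: reflect_def)

lemma reflect_less: "m > 0 \<Longrightarrow> reflect m v u < m"
  by (simp add: reflect_def nat_less_iff)

lemma reflect_reflect: "u < m \<Longrightarrow> reflect m v (reflect m v u) = u"
proof -
  assume u: "u < m"
  have "int (reflect m v (reflect m v u)) = (2 * int v - (2 * int v - int u) mod int m) mod int m"
    using u by (simp add: int_reflect)
  also have "\<dots> = int u mod int m"
    by (simp add: mod_diff_right_eq)
  finally show ?thesis using u by simp
qed

text \<open>Reflection negates differences modulo \<open>m\<close>: the term
  \<open>2 * int v\<close> cancels, so the arrows are reversed whatever \<open>S\<close> is.\<close>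

lemma circulant_reflect_iff:
  assumes "x < m" "y < m"
  shows "(reflect m v x, reflect m v y) \<in> circulant m S \<longleftrightarrow> (y, x) \<in> circulant m S"
proof -
  have "(int (reflect m v y) - int (reflect m v x)) mod int m = (int x - int y) mod int m"
    using assms by (simp add: int_reflect mod_diff_eq)
  then show ?thesis
    using assms by (simp add: circulant_def reflect_less)
qed

lemma reflect_self: "v < m \<Longrightarrow> reflect m v v = v"
  by (simp add: reflect_def)

text \<open>Since the reflection fixes \<open>v\<close> and reverses arrows, it exchanges the two
  neighbourhoods; being an involution, it serves as its own inverse.\<close>

lemma bij_betw_reflect_IN_OUT:
  assumes v: "v < m"
  shows "bij_betw (reflect m v) (IN {..<m} (circulant m S) v) (OUT {..<m} (circulant m S) v)"
proof (rule bij_betw_byWitness[where f' = "reflect m v"])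
  have iff: "(v, reflect m v u) \<in> circulant m S \<longleftrightarrow> (u, v) \<in> circulant m S"
    "(reflect m v u, v) \<in> circulant m S \<longleftrightarrow> (v, u) \<in> circulant m S" if "u < m" for u
    using circulant_reflect_iff[OF v that, of v S] circulant_reflect_iff[OF that v, of v S]
    by (simp_all add: reflect_self v)
  show "reflect m v ` IN {..<m} (circulant m S) v \<subseteq> OUT {..<m} (circulant m S) v"
    "reflect m v ` OUT {..<m} (circulant m S) v \<subseteq> IN {..<m} (circulant m S) v"
    using v by (auto simp: IN_def OUT_def iff reflect_less)
qed (auto simp: IN_def OUT_def reflect_reflect)

text \<open>The differences of the two orientations of a pair are \<open>d\<close> and
  \<open>int m - d\<close>, so \<open>compl\<close> orients each pair exactly once; it also forces
  \<open>m\<close> to be odd, by \<open>d = m/2\<close>. Reflections give the rest.\<close>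

lemma type_II_circulant:
  assumes "m > 0" and S: "0 \<notin> S"
    and compl: "\<And>d. 0 < d \<Longrightarrow> d < int m \<Longrightarrow> d \<in> S \<longleftrightarrow> int m - d \<notin> S"
  shows "type_II_tournament {..<m} (circulant m S)"
proof
  show "finite {..<m}" "{..<m} \<noteq> {}" "circulant m S \<subseteq> {..<m} \<times> {..<m}"
    using \<open>m > 0\<close> by (auto simp: circulant_def)
  show "(v, v) \<notin> circulant m S" for v
    using S by (simp add: circulant_def)
  show "(u, v) \<in> circulant m S \<longleftrightarrow> (v, u) \<notin> circulant m S"
    if "u \<in> {..<m}" "v \<in> {..<m}" "u \<noteq> v" for u v
  proof -
    let ?d = "(int v - int u) mod int m"
    have "?d \<noteq> 0"
    proof
      assume "?d = 0"
      then have "int v mod int m = int u mod int m" by (simp add: mod_eq_dvd_iff mod_0_imp_dvd)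
      with that show False by simp
    qed
    moreover from this have "(int u - int v) mod int m = int m - ?d"
      using zmod_zminus1_eq_if[of "int v - int u" "int m"] by simp
    moreover have "0 \<le> ?d" "?d < int m"
      using \<open>m > 0\<close> by simp_all
    ultimately show ?thesis
      using that compl[of ?d] by (simp add: circulant_def)
  qed
  show "card (IN {..<m} (circulant m S) v) = card (OUT {..<m} (circulant m S) v)"
    if "v \<in> {..<m}" for v
    using that bij_betw_reflect_IN_OUT bij_betw_same_card by blast
  have "isomorphic (IN {..<m} (circulant m S) 0) (Restr (circulant m S) (IN {..<m} (circulant m S) 0))
      (OUT {..<m} (circulant m S) 0) ((Restr (circulant m S) (OUT {..<m} (circulant m S) 0))\<inverse>)"
    unfolding isomorphic_def
  proof (intro exI conjI ballI)
    show bij: "bij_betw (reflect m 0) (IN {..<m} (circulant m S) 0) (OUT {..<m} (circulant m S) 0)"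
      using \<open>m > 0\<close> by (rule bij_betw_reflect_IN_OUT)
    fix x y
    assume x: "x \<in> IN {..<m} (circulant m S) 0" and y: "y \<in> IN {..<m} (circulant m S) 0"
    then have "x < m" "y < m" by (simp_all add: IN_def)
    then show "(x, y) \<in> Restr (circulant m S) (IN {..<m} (circulant m S) 0) \<longleftrightarrow>
        (reflect m 0 x, reflect m 0 y) \<in> (Restr (circulant m S) (OUT {..<m} (circulant m S) 0))\<inverse>"
      using x y bij_betwE[OF bij] by (simp add: circulant_reflect_iff)
  qed
  then show "\<exists>v\<in>{..<m}. isomorphic (IN {..<m} (circulant m S) v)
      (Restr (circulant m S) (IN {..<m} (circulant m S) v))
      (OUT {..<m} (circulant m S) v) ((Restr (circulant m S) (OUT {..<m} (circulant m S) v))\<inverse>)"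
    using \<open>m > 0\<close> by blast
qed

text \<open>If \<open>b < d\<close>, then \<open>2 ^ Suc b\<close> divides the other three powers,
  hence also \<open>2 ^ b\<close>, which is absurd.\<close>

lemma diff_powers_of_two_le:
  fixes a b c d :: nat
  assumes eq: "(2::int) ^ a - 2 ^ b = 2 ^ c - 2 ^ d" and "b < a" "d < c"
  shows "d \<le> b"
proof (rule ccontr)
  assume "\<not> d \<le> b"
  with assms have "(2::int) ^ Suc b dvd 2 ^ c" "(2::int) ^ Suc b dvd 2 ^ d" "(2::int) ^ Suc b dvd 2 ^ a"
    by (auto intro!: le_imp_power_dvd simp del: power_Suc)
  then have "(2::int) ^ Suc b dvd 2 ^ a - (2 ^ c - 2 ^ d)"
    by (intro dvd_diff)
  also have "2 ^ a - (2 ^ c - 2 ^ d) = (2::int) ^ b"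
    using eq by simp
  finally show False
    by (simp add: zdvd_not_zless)
qed

lemma diff_powers_of_two_eqD:
  fixes a b c d :: nat
  assumes eq: "(2::int) ^ a - 2 ^ b = 2 ^ c - 2 ^ d" and "b < a"
  shows "a = c \<and> b = d"
proof -
  have "(2::int) ^ b < 2 ^ a" using \<open>b < a\<close> by simp
  with eq have "(2::int) ^ d < 2 ^ c" by linarith
  then have "d < c" by simp
  then have "b = d"
    using diff_powers_of_two_le[OF eq \<open>b < a\<close>] diff_powers_of_two_le[OF eq[symmetric] _ \<open>b < a\<close>]
    by (simp add: antisym)
  with eq show ?thesis by simp
qed

theorem corollary4p8:
  fixes V :: "'a set" and E :: "'a rel"
  assumes "tournament V E"
  shows "\<exists>(W :: nat set) (F :: nat rel) (f :: 'a \<Rightarrow> nat).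
           type_II_tournament W F \<and> inj_on f V \<and> f ` V \<subseteq> W \<and>
           (\<forall>x\<in>V. \<forall>y\<in>V. (x, y) \<in> E \<longleftrightarrow> (f x, f y) \<in> F)"
proof -
  interpret tournament V E by fact
  obtain e where e: "bij_betw e V {0..<card V}"
    using ex_bij_betw_finite_nat[OF finite_verts] by blast
  define f :: "'a \<Rightarrow> nat" where "f x = 2 ^ e x" for x
  define N :: nat where "N = 2 ^ card V"
  define P where "P d \<longleftrightarrow> (\<exists>x\<in>V. \<exists>y\<in>V. (x, y) \<in> E \<and> int (f y) - int (f x) = d)" for d
  \<comment> \<open>With this odd modulus, \<open>d \<mapsto> m - d\<close> swaps the ranges 1 to
    \<open>N\<close> and \<open>N + 1\<close> to \<open>2 * N\<close>.\<close>
  define m where "m = 2 * N + 1"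
  \<comment> \<open>The lower range copies the arrows of \<open>E\<close>, and the upper range is
    the complement forced by \<open>compl\<close>. A lower difference realised by no arrow of
    \<open>E\<close> stays out of \<open>S\<close>.\<close>
  define S where "S = {d. 0 < d \<and> (if d \<le> int N then P d else \<not> P (int m - d))}"
  have inj: "inj_on f V"
    using e by (auto simp: f_def bij_betw_def inj_on_def)
  have f_less: "f x < N" if "x \<in> V" for x
    using bij_betwE[OF e] that by (auto simp: f_def N_def)
  have P_iff: "P (int (f y) - int (f x)) \<longleftrightarrow> (x, y) \<in> E"
    if xy: "x \<in> V" "y \<in> V" "f x < f y" for x y
  proof
    assume "P (int (f y) - int (f x))"
    then obtain x' y' where x'y': "x' \<in> V" "y' \<in> V" "(x', y') \<in> E"
      and "int (f y) - int (f x) = int (f y') - int (f x')"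
      unfolding P_def by metis
    \<comment> \<open>A positive difference of powers of two determines both exponents, so the arrow
      witnessing \<open>P\<close> can only be the one from \<open>x\<close> to
      \<open>y\<close>.\<close>
    then have "e y = e y' \<and> e x = e x'"
      using diff_powers_of_two_eqD[of "e y" "e x" "e y'" "e x'"] xy(3) by (simp add: f_def)
    then have "x = x'" "y = y'"
      using e xy x'y' by (auto simp: bij_betw_def dest: inj_onD)
    with x'y' show "(x, y) \<in> E" by simp
  qed (use xy in \<open>auto simp: P_def\<close>)
  have emb: "(x, y) \<in> E \<longleftrightarrow> (f x, f y) \<in> circulant m S" if xy: "x \<in> V" "y \<in> V" for x y
  proof -
    note less = f_less[OF xy(1)] f_less[OF xy(2)]
    then have m: "f x < m" "f y < m" by (simp_all add: m_def)
    consider "f x < f y" | "x = y" | "f y < f x"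
      using inj xy by (meson inj_onD nat_neq_iff)
    then show ?thesis
    proof cases
      case 1
      then have "(int (f y) - int (f x)) mod int m = int (f y) - int (f x)"
        using m by (intro mod_pos_pos_trivial) auto
      then show ?thesis
        using 1 less m P_iff[OF xy 1] by (simp add: circulant_def S_def)
    next
      case 2
      then show ?thesis using no_loops by (simp add: circulant_def S_def)
    next
      case 3
      \<comment> \<open>The negative difference wraps around to a residue above \<open>N\<close>,
        where membership in \<open>S\<close> is the negation of \<open>P\<close> at the opposite
        difference.\<close>
      have "(int (f y) - int (f x)) mod int m = (int (f y) - int (f x) + int m) mod int m"
        by simp
      also have "\<dots> = int m - (int (f x) - int (f y))"
        using 3 m by (subst mod_pos_pos_trivial) auto
      finally have "(f x, f y) \<in> circulant m S \<longleftrightarrow> \<not> P (int (f x) - int (f y))"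
        using 3 less m by (simp add: circulant_def S_def) (simp add: m_def)
      moreover have "(x, y) \<in> E \<longleftrightarrow> (y, x) \<notin> E"
        using exactly_one xy 3 by blast
      ultimately show ?thesis
        using P_iff[OF xy(2,1) 3] by simp
    qed
  qed
  have "type_II_tournament {..<m} (circulant m S)"
    \<comment> \<open>For \<open>0 < d < m\<close> exactly one of \<open>d\<close> and
      \<open>m - d\<close> is at most \<open>N\<close>, so the two branches of \<open>S\<close> give
      \<open>compl\<close>.\<close>
    by (rule type_II_circulant) (auto simp: m_def S_def)
  moreover have "f ` V \<subseteq> {..<m}"
    using f_less by (force simp: m_def)
  ultimately show ?thesis
    using inj emb by blast
qed

end
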